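(* Assume that the vector Bregman-PL inequality holds for $F$ on $\mathrm{int}(\Omega)$ with a function $\tau:\mathbb{R}_{++}\to\mathbb{R}_{++}$, i.e. $u_0(x)\le\tau(\ell')v_{\ell'}(x)$ for all $x\in\mathrm{int}(\Omega)$ and all $\ell'>0$, and that $F$ is $(L,C,e)$-smooth relative to $\omega$ for some $L>0$. If $\ell\ge L$, then the sequence $\{x^k\}$ generated by $x^{k+1}=V_\ell(x^k)$ from $x^0\in\mathrm{int}(\Omega)$ satisfies, for all $k\ge0$, $$u_0(x^{k+1})\le\left(1-\frac{1}{\tau(\ell)}\right)u_0(x^k).$$
   Context: $C\subset\mathbb{R}^m$ is a closed, convex, pointed cone with nonempty interior; $y\preceq_C y'$ means $y'-y\in C$. $C^*=\{c^*\in\mathbb{R}^m:\langle c^*,c\rangle\ge 0\ \forall c\in C\}$ and $G=\mathrm{conv}(\{c^*\in C^*:\|c^*\|=1\})$. $\Omega\subset\mathbb{R}^n$ is closed and convex with nonempty interior, $F:\mathbb{R}^n\to\mathbb{R}^m$ is differentiable with Jacobian $JF(x)\in\mathbb{R}^{m\times n}$. A point $x^*\in\Omega$ is $C$-stationary if $JF(x^* )(\Omega-x^* )\cap(-\mathrm{int}(C))=\emptyset$. Legendre function: a proper closed convex function $\omega$ on $\mathbb{R}^n$ with values in $(-\infty,+\infty]$ that is essentially smooth (differentiable on $\mathrm{int}(\mathrm{dom}\,\omega)$, with $\|\nabla\omega(x^k)\|\to\infty$ for every sequence $\{x^k\}\subset\mathrm{int}(\mathrm{dom}\,\omega)$ converging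 to a boundary point of $\mathrm{dom}\,\omega$) and strictly convex on $\mathrm{int}(\mathrm{dom}\,\omega)$. Here $\omega$ is a Legendre function with $\mathrm{cl}(\mathrm{dom}\,\omega)=\Omega$, and it is supercoercive: $\lim_{\|x\|\to\infty}\omega(x)/\|x\|=\infty$. Bregman distance: $D_\omega(x,y)=\omega(x)-\omega(y)-\langle\nabla\omega(y),x-y\rangle$ for $y\in\mathrm{int}(\mathrm{dom}\,\omega)$ (equal to $+\infty$ when $\omega(x)=+\infty$). The vector $e$: $e=\arg\max_{c\in B[0,r]}\min_{c^*\in G}\langle c^*,c\rangle$, where $B[0,r]$ is the closed ball of radius $r$ centred at $0$ and $r>0$ is selected so that $\max_{c^*\in G}\langle c^*,e\rangle=1$; then $e\in\mathrm{int}(C)$. Relative smoothness: $F$ is $(L,C,e)$-smooth relative to $\omega$ (on $\Omega\subseteq\mathrm{dom}(\omega)$), with $L>0$, if $F(y)\preceq_C F(x)+JF(x)(y-x)+LD_\omega(y,x)e$ for all $x,y\in\mathrm{int}(\Omega)$. Merit functions: $u_0(x)=\sup_{y\in\Omega}\min_{c^*\in G}\langle c^*,F(x)-F(y)\rangle$ and, for $\ell>0$, $v_\ell(x)=\sup_{y\in\Omega}\min_{c^*\in G}\{\langle c^*,JF(x)(x-y)\rangle-\ell D_\omega(y,x)\}$. For $x\in\mathrm{int}(\Omega)$, $V_\ell(x)$ is the unique maximizer $y$ in the definition of $v_\ell(x)$; it lies in $\mathrm{int}(\Omega)$ (well defined since $\omega$ is supercoercive). The interior Bregman gradient method starts at $x^0\in\mathrm{int}(\Omega)$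 and iterates $x^{k+1}=V_\ell(x^k)$, stopping if $x^{k+1}=x^k$; it is assumed throughout that it generates an infinite sequence of points that are not $C$-stationary. *)

theory Defs
  imports "HOL-Analysis.Analysis"
begin

section \<open>Cones and scalarization\<close>

definition pointed :: "'a::real_vector set \<Rightarrow> bool" where
  "pointed C \<longleftrightarrow> C \<inter> uminus ` C = {0}"

definition cone_le :: "'a::real_vector set \<Rightarrow> 'a \<Rightarrow> 'a \<Rightarrow> bool" where
  "cone_le C y y' \<longleftrightarrow> y' - y \<in> C"

definition dual_cone :: "'a::real_inner set \<Rightarrow> 'a set" where
  "dual_cone C = {c'. \<forall>c\<in>C. 0 \<le> c' \<bullet> c}"

definition dual_base :: "'a::real_inner set \<Rightarrow> 'a set" where
  "dual_base C = convex hull {c' \<in> dual_cone C. norm c' = 1}"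

text \<open>For a closed convex pointed cone \<open>C\<close> with nonempty interior in a Euclidean space, \<open>dual_base C\<close>
  is nonempty and compact, so the infima and suprema over it of real linear functions
  below are attained, i.e. they are the minima and maxima they stand for.\<close>

definition normalized_direction :: "'a::real_inner set \<Rightarrow> 'a \<Rightarrow> bool" where
  "normalized_direction C e \<longleftrightarrow>
     (\<exists>r>0. is_arg_max (\<lambda>c. INF c'\<in>dual_base C. c' \<bullet> c) (\<lambda>c. c \<in> cball 0 r) e) \<and>
     (SUP c'\<in>dual_base C. c' \<bullet> e) = 1"

definition C_stationary ::
  "(real^'m) set \<Rightarrow> (real^'n) set \<Rightarrow> (real^'n \<Rightarrow> real^'m) \<Rightarrow> real^'n \<Rightarrow> bool" where
  "C_stationary C \<Omega> F x \<longleftrightarrow>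
     x \<in> \<Omega> \<and> (\<lambda>y. jacobian F (at x) *v (y - x)) ` \<Omega> \<inter> uminus ` interior C = {}"

section \<open>Legendre functions and Bregman distances\<close>

definition edom :: "('a \<Rightarrow> ereal) \<Rightarrow> 'a set" where
  "edom \<omega> = {x. \<omega> x < \<infinity>}"

definition eepigraph :: "('a \<Rightarrow> ereal) \<Rightarrow> ('a \<times> real) set" where
  "eepigraph \<omega> = {(x, t). \<omega> x \<le> ereal t}"

text \<open>Meaningful at interior points of \<open>edom \<omega>\<close>, where \<open>\<omega>\<close> is finite on a neighbourhood.\<close>

definition grad :: "('a::real_inner \<Rightarrow> ereal) \<Rightarrow> 'a \<Rightarrow> 'a" where
  "grad \<omega> x = (THE g. GDERIV (\<lambda>z. real_of_ereal (\<omega> z)) x :> g)"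

definition proper_closed_convex :: "('a::real_normed_vector \<Rightarrow> ereal) \<Rightarrow> bool" where
  "proper_closed_convex \<omega> \<longleftrightarrow>
     (\<forall>x. \<omega> x \<noteq> -\<infinity>) \<and> (\<exists>x. \<omega> x \<noteq> \<infinity>) \<and> closed (eepigraph \<omega>) \<and> convex (eepigraph \<omega>)"

definition essentially_smooth :: "('a::real_inner \<Rightarrow> ereal) \<Rightarrow> bool" where
  "essentially_smooth \<omega> \<longleftrightarrow>
     (\<forall>x\<in>interior (edom \<omega>). (\<lambda>z. real_of_ereal (\<omega> z)) differentiable (at x)) \<and>
     (\<forall>s z. (\<forall>k. s k \<in> interior (edom \<omega>)) \<longrightarrow> z \<in> frontier (edom \<omega>) \<longrightarrow> s \<longlonglongrightarrow> z \<longrightarrow>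
        filterlim (\<lambda>k. norm (grad \<omega> (s k))) at_top sequentially)"

definition strictly_convex_on :: "'a::real_vector set \<Rightarrow> ('a \<Rightarrow> ereal) \<Rightarrow> bool" where
  "strictly_convex_on S \<omega> \<longleftrightarrow> convex S \<and>
     (\<forall>x\<in>S. \<forall>y\<in>S. x \<noteq> y \<longrightarrow> (\<forall>t. 0 < t \<and> t < 1 \<longrightarrow>
        \<omega> ((1 - t) *\<^sub>R x + t *\<^sub>R y) < ereal (1 - t) * \<omega> x + ereal t * \<omega> y))"

definition Legendre :: "('a::real_inner \<Rightarrow> ereal) \<Rightarrow> bool" where
  "Legendre \<omega> \<longleftrightarrow> proper_closed_convex \<omega> \<and> essentially_smooth \<omega> \<and>
     strictly_convex_on (interior (edom \<omega>)) \<omega>"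

definition supercoercive :: "('a::real_normed_vector \<Rightarrow> ereal) \<Rightarrow> bool" where
  "supercoercive \<omega> \<longleftrightarrow> ((\<lambda>x. \<omega> x / ereal (norm x)) \<longlongrightarrow> \<infinity>) at_infinity"

text \<open>The second argument is meant to lie in the interior of \<open>edom \<omega>\<close>; the value is then
  \<open>\<infinity>\<close> exactly when \<open>\<omega> x = \<infinity>\<close>.\<close>

definition bregman :: "('a::real_inner \<Rightarrow> ereal) \<Rightarrow> 'a \<Rightarrow> 'a \<Rightarrow> ereal" where
  "bregman \<omega> x y = \<omega> x - \<omega> y - ereal (grad \<omega> y \<bullet> (x - y))"

text \<open>The coercion \<open>real_of_ereal\<close> is harmless: \<open>S \<subseteq> edom \<omega>\<close> makes the distance finite.\<close>

definition relatively_smooth_on ::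
  "(real^'n) set \<Rightarrow> real \<Rightarrow> (real^'m) set \<Rightarrow> real^'m \<Rightarrow> (real^'n \<Rightarrow> ereal) \<Rightarrow>
   (real^'n \<Rightarrow> real^'m) \<Rightarrow> bool" where
  "relatively_smooth_on S L C e \<omega> F \<longleftrightarrow> S \<subseteq> edom \<omega> \<and>
     (\<forall>x\<in>interior S. \<forall>y\<in>interior S.
        cone_le C (F y)
          (F x + jacobian F (at x) *v (y - x) + (L * real_of_ereal (bregman \<omega> y x)) *\<^sub>R e))"

section \<open>Merit functions and the Bregman gradient step\<close>

definition merit_u0 ::
  "'b::real_inner set \<Rightarrow> 'a set \<Rightarrow> ('a \<Rightarrow> 'b) \<Rightarrow> 'a \<Rightarrow> ereal" where
  "merit_u0 C \<Omega> F x = (SUP y\<in>\<Omega>. INF c\<in>dual_base C. ereal (c \<bullet> (F x - F y)))"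

definition bregman_obj ::
  "(real^'m) set \<Rightarrow> (real^'n \<Rightarrow> ereal) \<Rightarrow> (real^'n \<Rightarrow> real^'m) \<Rightarrow> real \<Rightarrow> real^'n \<Rightarrow> real^'n \<Rightarrow> ereal"
where
  "bregman_obj C \<omega> F l x y =
     (INF c\<in>dual_base C. ereal (c \<bullet> (jacobian F (at x) *v (x - y))) - ereal l * bregman \<omega> y x)"

definition merit_v ::
  "(real^'m) set \<Rightarrow> (real^'n) set \<Rightarrow> (real^'n \<Rightarrow> ereal) \<Rightarrow> (real^'n \<Rightarrow> real^'m) \<Rightarrow> real \<Rightarrow>
   real^'n \<Rightarrow> ereal" where
  "merit_v C \<Omega> \<omega> F l x = (SUP y\<in>\<Omega>. bregman_obj C \<omega> F l x y)"

definition bregman_step ::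
  "(real^'m) set \<Rightarrow> (real^'n) set \<Rightarrow> (real^'n \<Rightarrow> ereal) \<Rightarrow> (real^'n \<Rightarrow> real^'m) \<Rightarrow> real \<Rightarrow>
   real^'n \<Rightarrow> real^'n" where
  "bregman_step C \<Omega> \<omega> F l x = (THE y. is_arg_max (bregman_obj C \<omega> F l x) (\<lambda>y. y \<in> \<Omega>) y)"

end

theory Submission
  imports Defs
begin

text \<open>Relative smoothness turns the value of the Bregman step into a decrease of every
  scalarization of \<open>F\<close> by at least \<open>v\<^sub>\<ell>(x\<^sup>k)\<close>, because \<open>\<langle>c\<^sup>*, e\<rangle> \<le> 1\<close> and \<open>L \<le> \<ell>\<close>. Hence
  \<open>u\<^sub>0(x\<^sup>k\<^sup>+\<^sup>1) \<le> u\<^sub>0(x\<^sup>k) - v\<^sub>\<ell>(x\<^sup>k)\<close>, and the Bregman-PL inequality bounds \<open>v\<^sub>\<ell>(x\<^sup>k)\<close> from below.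
  The bulk of the work is that the step is well defined and stays in the interior: the subproblem
  minimizes \<open>\<ell> \<omega> - q\<close> with \<open>q\<close> concave and Lipschitz. Supercoercivity makes a slice of the epigraph
  compact, which gives a minimizer; essential smoothness makes \<open>\<omega>\<close> infinitely steep at boundary
  points, which excludes them; strict convexity in the interior gives uniqueness.\<close>

section \<open>The dual base and the normalized direction\<close>

lemma dual_cone_convex: "convex (dual_cone C)"
  unfolding convex_def dual_cone_def by (auto simp: inner_add_left)

lemma dual_base_subset_dual_cone: "dual_base C \<subseteq> dual_cone C"
  unfolding dual_base_def by (rule hull_minimal) (auto simp: dual_cone_convex)

lemma dual_base_norm_le: "c \<in> dual_base C \<Longrightarrow> norm c \<le> 1"
proof -
  have "dual_base C \<subseteq> cball 0 1"
    unfolding dual_base_def by (rule hull_minimal) auto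
  then show "c \<in> dual_base C \<Longrightarrow> norm c \<le> 1" by auto
qed

text \<open>Pointedness makes \<open>C\<close> a proper subset, so a hyperplane strictly separates
  some point from \<open>C\<close>. Its normal is nonnegative on \<open>C\<close>, since a negative
  value could be scaled down to the separating level; normalizing it gives an element of the
  base.\<close>

lemma dual_base_nonempty:
  fixes C :: "'a::euclidean_space set"
  assumes "closed C" "convex C" "cone C" "pointed C"
  shows "dual_base C \<noteq> {}"
proof -
  have C0: "0 \<in> C" using \<open>pointed C\<close> unfolding pointed_def by auto
  have "\<exists>z. z \<notin> C"
  proof -
    obtain b :: 'a where b: "b \<in> Basis" using nonempty_Basis by blast
    then have "b \<noteq> 0" by auto
    then have "b \<notin> C \<inter> uminus ` C" using \<open>pointed C\<close> unfolding pointed_def by auto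
    then have "b \<notin> C \<or> - b \<notin> C" by (metis IntI add.inverse_inverse image_eqI)
    then show ?thesis by auto
  qed
  then obtain z where "z \<notin> C" by auto
  then obtain a b where a: "a \<bullet> z < b" "\<And>c. c \<in> C \<Longrightarrow> b < a \<bullet> c"
    using separating_hyperplane_closed_point[of C z] assms by metis
  have b0: "b < 0" using a(2)[OF C0] by simp
  have pos: "0 \<le> a \<bullet> c" if "c \<in> C" for c
  proof (rule ccontr)
    assume neg: "\<not> 0 \<le> a \<bullet> c"
    define s where "s = b / (a \<bullet> c)"
    have "0 \<le> s" unfolding s_def using neg b0 by (simp add: divide_nonpos_nonpos)
    then have "s *\<^sub>R c \<in> C" using \<open>cone C\<close> that unfolding cone_def by auto
    then have "b < s * (a \<bullet> c)" using a(2) by fastforce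
    then show False unfolding s_def using neg by simp
  qed
  have "a \<noteq> 0" using a(1) b0 by auto
  then have "a /\<^sub>R norm a \<in> {c' \<in> dual_cone C. norm c' = 1}"
    using pos by (auto simp: dual_cone_def)
  then have "a /\<^sub>R norm a \<in> dual_base C" unfolding dual_base_def by (rule hull_inc)
  then show ?thesis by auto
qed

lemma inner_normalized_direction_le:
  assumes "normalized_direction C e" "c \<in> dual_base C"
  shows "c \<bullet> e \<le> 1"
proof -
  have "bdd_above ((\<lambda>c. c \<bullet> e) ` dual_base C)"
  proof (rule bdd_aboveI2)
    fix c assume "c \<in> dual_base C"
    then have "norm c * norm e \<le> 1 * norm e"
      by (intro mult_right_mono dual_base_norm_le) auto
    then show "c \<bullet> e \<le> norm e" using norm_cauchy_schwarz[of c e] by simp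
  qed
  then have "c \<bullet> e \<le> (SUP c\<in>dual_base C. c \<bullet> e)"
    by (rule cSUP_upper[OF assms(2)])
  then show ?thesis using assms(1) unfolding normalized_direction_def by simp
qed

section \<open>Lower support functions\<close>

text \<open>Up to sign this is the support function of \<open>- G\<close>. Being real-valued, it
  replaces the extended-real infima of the merit functions in calculations.\<close>

definition lower_support :: "'a::real_inner set \<Rightarrow> 'a \<Rightarrow> real" where
  "lower_support G v = (INF c\<in>G. c \<bullet> v)"

context
  fixes G :: "'a::real_inner set"
  assumes G_nonempty: "G \<noteq> {}" and G_norm: "\<And>c. c \<in> G \<Longrightarrow> norm c \<le> 1"
begin

lemma inner_ge_neg_norm: "c \<in> G \<Longrightarrow> - norm v \<le> c \<bullet> v"
proof -
  assume "c \<in> G"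
  then have "norm c * norm v \<le> 1 * norm v" by (intro mult_right_mono G_norm) auto
  then show ?thesis using Cauchy_Schwarz_ineq2[of c v] by linarith
qed

lemma lower_support_le: "c \<in> G \<Longrightarrow> lower_support G v \<le> c \<bullet> v"
  unfolding lower_support_def
  by (rule cINF_lower[OF bdd_belowI2[of _ "- norm v"]]) (auto intro: inner_ge_neg_norm)

lemma lower_support_greatest: "(\<And>c. c \<in> G \<Longrightarrow> a \<le> c \<bullet> v) \<Longrightarrow> a \<le> lower_support G v"
  unfolding lower_support_def using G_nonempty by (rule cINF_greatest)

lemma lower_support_ge: "- norm v \<le> lower_support G v"
  by (intro lower_support_greatest inner_ge_neg_norm)

lemma lower_support_superadd:
  "lower_support G u + lower_support G v \<le> lower_support G (u + v)"
  by (intro lower_support_greatest) (auto simp: inner_add_right intro!: add_mono lower_support_le)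

lemma lower_support_scale:
  assumes "0 \<le> t" shows "t * lower_support G v \<le> lower_support G (t *\<^sub>R v)"
  using assms by (intro lower_support_greatest) (auto intro!: mult_left_mono lower_support_le)

text \<open>Superadditivity along \<open>v = u + (v - u)\<close> and the lower bound at
  \<open>v - u\<close> give Lipschitz continuity with constant 1.\<close>

lemma lower_support_diff_le: "lower_support G u - lower_support G v \<le> norm (u - v)"
  using lower_support_superadd[of u "v - u"] lower_support_ge[of "v - u"]
  by (simp add: norm_minus_commute)

lemma INF_ereal_lower_support:
  "(INF c\<in>G. ereal (c \<bullet> v) - ereal d) = ereal (lower_support G v - d)"
proof (rule antisym)
  show "ereal (lower_support G v - d) \<le> (INF c\<in>G. ereal (c \<bullet> v) - ereal d)"
    by (intro INF_greatest) (auto intro: lower_support_le)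
  have ne: "(INF c\<in>G. ereal (c \<bullet> v) - ereal d) \<le> ereal (c \<bullet> v - d)" if "c \<in> G" for c
    using that by (auto intro!: INF_lower2)
  show "(INF c\<in>G. ereal (c \<bullet> v) - ereal d) \<le> ereal (lower_support G v - d)"
  proof (cases "INF c\<in>G. ereal (c \<bullet> v) - ereal d")
    case (real r)
    then have "r + d \<le> c \<bullet> v" if "c \<in> G" for c using ne[OF that] by simp
    then have "r + d \<le> lower_support G v" by (rule lower_support_greatest)
    then show ?thesis using real by simp
  next
    case PInf
    then show ?thesis using ne G_nonempty by auto
  qed auto
qed

end

section \<open>Convexity on the effective domain\<close>

lemma proper_edom_ereal:
  assumes "proper_closed_convex \<omega>" "z \<in> edom \<omega>"
  shows "ereal (real_of_ereal (\<omega> z)) = \<omega> z"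
  using assms unfolding proper_closed_convex_def edom_def by (cases "\<omega> z") auto

lemma edom_eq_fst_eepigraph:
  assumes "proper_closed_convex \<omega>"
  shows "edom \<omega> = fst ` eepigraph \<omega>"
proof (intro equalityI subsetI)
  fix z assume "z \<in> edom \<omega>"
  then have "(z, real_of_ereal (\<omega> z)) \<in> eepigraph \<omega>"
    using proper_edom_ereal[OF assms] unfolding eepigraph_def by auto
  then show "z \<in> fst ` eepigraph \<omega>" by force
next
  fix z assume "z \<in> fst ` eepigraph \<omega>"
  then obtain t where "\<omega> z \<le> ereal t" unfolding eepigraph_def by auto
  then show "z \<in> edom \<omega>" unfolding edom_def by (auto intro: le_less_trans)
qed

lemma convex_edom: "proper_closed_convex \<omega> \<Longrightarrow> convex (edom \<omega>)"
  by (simp add: edom_eq_fst_eepigraph proper_closed_convex_def convex_linear_image linear_fst)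

lemma convex_on_edom:
  assumes "proper_closed_convex \<omega>"
  shows "convex_on (edom \<omega>) (\<lambda>z. real_of_ereal (\<omega> z))"
proof (rule convex_onI)
  fix t :: real and u v
  assume t: "0 < t" "t < 1" and uv: "u \<in> edom \<omega>" "v \<in> edom \<omega>"
  let ?f = "\<lambda>z. real_of_ereal (\<omega> z)"
  have "(u, ?f u) \<in> eepigraph \<omega>" "(v, ?f v) \<in> eepigraph \<omega>"
    using proper_edom_ereal[OF assms] uv unfolding eepigraph_def by auto
  moreover have "convex (eepigraph \<omega>)" using assms unfolding proper_closed_convex_def by simp
  ultimately have "(1 - t) *\<^sub>R (u, ?f u) + t *\<^sub>R (v, ?f v) \<in> eepigraph \<omega>"
    using t by (intro convexD) auto
  then have le: "\<omega> ((1 - t) *\<^sub>R u + t *\<^sub>R v) \<le> ereal ((1 - t) * ?f u + t * ?f v)"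
    unfolding eepigraph_def by simp
  moreover have "(1 - t) *\<^sub>R u + t *\<^sub>R v \<in> edom \<omega>"
    using convexD[OF convex_edom[OF assms] uv] t by auto
  ultimately show "?f ((1 - t) *\<^sub>R u + t *\<^sub>R v) \<le> (1 - t) * ?f u + t * ?f v"
    using proper_edom_ereal[OF assms] by (metis ereal_less_eq(3))
qed (rule convex_edom[OF assms])

section \<open>Gradients of Legendre functions\<close>

lemma grad_gderiv:
  fixes \<omega> :: "'a::euclidean_space \<Rightarrow> ereal"
  assumes "(\<lambda>z. real_of_ereal (\<omega> z)) differentiable (at x)"
  shows "GDERIV (\<lambda>z. real_of_ereal (\<omega> z)) x :> grad \<omega> x"
proof -
  let ?f = "\<lambda>z. real_of_ereal (\<omega> z)"
  obtain f' where f': "(?f has_derivative f') (at x)"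
    using assms unfolding differentiable_def by auto
  interpret bounded_linear f' using f' by (rule has_derivative_bounded_linear)
  \<comment> \<open>The adjoint at 1 is the Riesz representer of the derivative, which settles
    existence of the gradient; uniqueness is still needed for the definite description in
    \<open>grad\<close>.\<close>
  have "f' = (\<lambda>h. h \<bullet> adjoint f' 1)"
    using adjoint_works[OF linear_axioms, of _ 1] by (simp add: fun_eq_iff)
  then have "GDERIV ?f x :> adjoint f' 1" unfolding gderiv_def using f' by simp
  moreover have "g = g'" if "GDERIV ?f x :> g" "GDERIV ?f x :> g'" for g g'
  proof -
    have "(\<lambda>h. h \<bullet> g) = (\<lambda>h. h \<bullet> g')"
      using that has_derivative_unique unfolding gderiv_def by blast
    then have "\<forall>h. h \<bullet> g = h \<bullet> g'" by metis
    then show "g = g'" by (simp only: vector_eq_ldot)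
  qed
  ultimately show ?thesis unfolding grad_def by (metis theI)
qed

text \<open>By convexity the difference quotients from \<open>x\<close> towards \<open>y\<close> are
  at most \<open>?f y - ?f x\<close>, and they tend to the directional derivative. Letting
  \<open>y\<close> be a boundary point of the domain matters for the steepness argument.\<close>

lemma grad_inequality:
  fixes \<omega> :: "'a::euclidean_space \<Rightarrow> ereal"
  assumes \<omega>: "Legendre \<omega>" and x: "x \<in> interior (edom \<omega>)" and y: "y \<in> edom \<omega>"
  shows "real_of_ereal (\<omega> x) + grad \<omega> x \<bullet> (y - x) \<le> real_of_ereal (\<omega> y)"
proof -
  let ?f = "\<lambda>z. real_of_ereal (\<omega> z)"
  have conv: "convex_on (edom \<omega>) ?f" using \<omega> convex_on_edom unfolding Legendre_def by auto
  have "?f differentiable (at x)"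
    using \<omega> x unfolding Legendre_def essentially_smooth_def by auto
  \<comment> \<open>The base point is written as the segment at parameter 0, the form the chain rule
    expects.\<close>
  then have der: "(?f has_derivative (\<lambda>h. h \<bullet> grad \<omega> x)) (at (x + 0 *\<^sub>R (y - x)))"
    using grad_gderiv unfolding gderiv_def by auto
  have "((\<lambda>t. x + t *\<^sub>R (y - x)) has_derivative (\<lambda>t. t *\<^sub>R (y - x))) (at 0)"
    by (auto intro!: derivative_eq_intros)
  from has_derivative_compose[OF this der]
  have "((\<lambda>t. ?f (x + t *\<^sub>R (y - x))) has_derivative (*) (grad \<omega> x \<bullet> (y - x))) (at 0)"
    by (simp add: inner_commute mult.commute[of "grad \<omega> x \<bullet> (y - x)", abs_def])
  then have "((\<lambda>t. ?f (x + t *\<^sub>R (y - x))) has_real_derivative grad \<omega> x \<bullet> (y - x)) (at 0)"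
    by (rule has_derivative_imp_has_field_derivative) simp
  then have "((\<lambda>t. (?f (x + t *\<^sub>R (y - x)) - ?f x) / t) \<longlongrightarrow> grad \<omega> x \<bullet> (y - x)) (at_right 0)"
    unfolding DERIV_def by (auto intro: tendsto_within_subset)
  moreover have "\<forall>\<^sub>F t in at_right 0. (?f (x + t *\<^sub>R (y - x)) - ?f x) / t \<le> ?f y - ?f x"
  proof -
    have "(?f (x + t *\<^sub>R (y - x)) - ?f x) / t \<le> ?f y - ?f x" if "0 < t" "t < 1" for t
    proof -
      have "?f ((1 - t) *\<^sub>R x + t *\<^sub>R y) \<le> (1 - t) * ?f x + t * ?f y"
        using conv that x y interior_subset by (intro convex_onD) auto
      moreover have "(1 - t) *\<^sub>R x + t *\<^sub>R y = x + t *\<^sub>R (y - x)" by (simp add: algebra_simps)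
      ultimately show ?thesis using that by (simp add: field_simps)
    qed
    then show ?thesis unfolding eventually_at_right_field by (intro exI[of _ 1]) auto
  qed
  ultimately have "grad \<omega> x \<bullet> (y - x) \<le> ?f y - ?f x"
    by (intro tendsto_upperbound) auto
  then show ?thesis by simp
qed

text \<open>If the gradients blow up along the segment from a boundary point \<open>y\<close> to an interior point \<open>z\<close>,
  then so does the slope in the direction \<open>z - y\<close>: test the gradient inequality at the point of a ball
  around \<open>z\<close> lying farthest in the direction of the gradient.\<close>

lemma Legendre_steep_at_boundary:
  fixes \<omega> :: "'a::euclidean_space \<Rightarrow> ereal"
  assumes \<omega>: "Legendre \<omega>" and z: "z \<in> interior (edom \<omega>)"
    and y: "y \<in> edom \<omega>" "y \<notin> interior (edom \<omega>)"
  shows "\<exists>t. 0 < t \<and> t < 1 \<and>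
    real_of_ereal (\<omega> (y + t *\<^sub>R (z - y))) < real_of_ereal (\<omega> y) - t * K"
proof -
  let ?f = "\<lambda>z. real_of_ereal (\<omega> z)"
  have pcc: "proper_closed_convex \<omega>" and es: "essentially_smooth \<omega>"
    using \<omega> unfolding Legendre_def by auto
  define t where "t n = inverse (real (Suc (Suc n)))" for n
  have t: "0 < t n" "t n < 1" "t n \<le> 1/2" for n by (auto simp: t_def field_simps)
  have t0: "t \<longlonglongrightarrow> 0" unfolding t_def by (rule LIMSEQ_Suc[OF LIMSEQ_inverse_real_of_nat])
  define s where "s n = y + t n *\<^sub>R (z - y)" for n
  have s_int: "s n \<in> interior (edom \<omega>)" for n
    using mem_interior_convex_shrink[OF convex_edom[OF pcc] z y(1), of "t n"] t[of n]
    by (simp add: s_def algebra_simps)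
  have "s \<longlonglongrightarrow> y + 0 *\<^sub>R (z - y)" unfolding s_def by (intro tendsto_intros t0)
  moreover have "y \<in> frontier (edom \<omega>)"
    using y closure_subset unfolding frontier_def by auto
  ultimately have blowup: "filterlim (\<lambda>n. norm (grad \<omega> (s n))) at_top sequentially"
    using es s_int unfolding essentially_smooth_def by auto
  obtain \<epsilon> where \<epsilon>: "0 < \<epsilon>" "cball z \<epsilon> \<subseteq> interior (edom \<omega>)"
    using z open_contains_cball[of "interior (edom \<omega>)"] by auto
  have "continuous_on (cball z \<epsilon>) ?f"
  proof (rule differentiable_imp_continuous_on, unfold differentiable_on_def, rule ballI)
    fix u assume "u \<in> cball z \<epsilon>"
    then have "?f differentiable (at u)"
      using es \<epsilon>(2) unfolding essentially_smooth_def by blast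
    then show "?f differentiable (at u within cball z \<epsilon>)" by (rule differentiable_at_withinI)
  qed
  then have "bounded (?f ` cball z \<epsilon>)"
    by (intro compact_imp_bounded compact_continuous_image) auto
  then obtain M where M: "\<And>u. u \<in> cball z \<epsilon> \<Longrightarrow> \<bar>?f u\<bar> \<le> M"
    unfolding bounded_iff real_norm_def by blast
  define N where "N = norm (grad \<omega> z) * norm (z - y)"
  \<comment> \<open>The affine minorant at \<open>z\<close> bounds \<open>?f\<close> from below
    along the whole segment, uniformly in \<open>n\<close>.\<close>
  have lower: "- M - N \<le> ?f (s n)" for n
  proof -
    have "?f z + grad \<omega> z \<bullet> (s n - z) \<le> ?f (s n)"
      using s_int[of n] interior_subset by (intro grad_inequality[OF \<omega> z]) auto
    moreover have "\<bar>grad \<omega> z \<bullet> (s n - z)\<bar> \<le> N"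
    proof -
      have "s n - z = (t n - 1) *\<^sub>R (z - y)" by (simp add: s_def algebra_simps)
      then have "norm (s n - z) = \<bar>t n - 1\<bar> * norm (z - y)" by simp
      also have "\<dots> \<le> 1 * norm (z - y)" using t[of n] by (intro mult_right_mono) auto
      finally have "norm (s n - z) \<le> norm (z - y)" by simp
      then have "norm (grad \<omega> z) * norm (s n - z) \<le> N"
        unfolding N_def by (intro mult_left_mono) auto
      then show ?thesis using Cauchy_Schwarz_ineq2 order_trans by blast
    qed
    moreover have "\<bar>?f z\<bar> \<le> M" using M[of z] \<epsilon> by simp
    ultimately show ?thesis by linarith
  qed
  \<comment> \<open>The term 2M + N absorbs the gap between the upper bound M of \<open>?f\<close>
    on the ball and the lower bound -M - N at \<open>s n\<close>; the remaining |K| + 1 makes the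
    slope \<open>d\<close> smaller than -|K|.\<close>
  obtain n where n: "(2 * M + N + \<bar>K\<bar> + 1) / \<epsilon> \<le> norm (grad \<omega> (s n))"
    using blowup unfolding filterlim_at_top eventually_sequentially by blast
  define g where "g = grad \<omega> (s n)"
  define d where "d = g \<bullet> (z - y)"
  have big: "2 * M + N + \<bar>K\<bar> + 1 \<le> \<epsilon> * norm g"
    using n \<epsilon>(1) unfolding g_def by (simp add: field_simps)
  define w where "w = z + \<epsilon> *\<^sub>R sgn g"
  have w: "w \<in> cball z \<epsilon>" unfolding w_def using \<epsilon>(1) by (auto simp: dist_norm norm_sgn)
  have "?f (s n) + g \<bullet> (w - s n) \<le> ?f w"
    unfolding g_def using w \<epsilon>(2) interior_subset by (intro grad_inequality[OF \<omega> s_int]) blast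
  moreover have "g \<bullet> (w - s n) = (1 - t n) * d + \<epsilon> * norm g"
  proof -
    have "w - s n = (1 - t n) *\<^sub>R (z - y) + \<epsilon> *\<^sub>R sgn g"
      by (simp add: w_def s_def algebra_simps)
    moreover have "g \<bullet> sgn g = norm g"
      by (cases "g = 0") (simp_all add: sgn_div_norm dot_square_norm power2_eq_square)
    ultimately show ?thesis by (simp add: inner_add_right d_def)
  qed
  ultimately have "(1 - t n) * d \<le> - \<bar>K\<bar> - 1"
    using M[OF w] lower[of n] big by linarith
  then have "d < - \<bar>K\<bar>"
  proof -
    assume h: "(1 - t n) * d \<le> - \<bar>K\<bar> - 1"
    then have "d < 0" using t(2)[of n] by (smt (verit) mult_nonneg_nonneg)
    then have "d \<le> (1 - t n) * d" using t[of n] by (simp add: algebra_simps mult_le_0_iff)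
    then show ?thesis using h by linarith
  qed
  then have "t n * d < t n * (- K)" using t(1)[of n] by (intro mult_strict_left_mono) auto
  \<comment> \<open>The same gradient, now tested at the boundary point \<open>y\<close>, turns the
    bound on \<open>d\<close> into a drop of \<open>?f\<close> from \<open>y\<close> to
    \<open>s n\<close>.\<close>
  moreover have "?f (s n) + g \<bullet> (y - s n) \<le> ?f y"
    unfolding g_def by (rule grad_inequality[OF \<omega> s_int y(1)])
  moreover have "g \<bullet> (y - s n) = - (t n * d)"
    by (simp add: s_def d_def)
  ultimately have "?f (s n) < ?f y - t n * K" by (simp add: algebra_simps)
  then show ?thesis using t unfolding s_def by blast
qed

section \<open>Minimizing a Legendre function minus a concave Lipschitz function\<close>

text \<open>The minimization is lifted to the epigraph: there the objective \<open>J\<close> is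
  continuous, and lower semicontinuity of \<omega> is encoded as closedness of the epigraph.\<close>

lemma Legendre_minus_lipschitz_attains_min:
  fixes \<omega> :: "'a::euclidean_space \<Rightarrow> ereal"
  assumes \<omega>: "Legendre \<omega>" "supercoercive \<omega>" and x: "x \<in> interior (edom \<omega>)"
    and q: "B-lipschitz_on UNIV q" and l: "0 < l"
  shows "\<exists>y\<in>edom \<omega>. \<forall>z\<in>edom \<omega>.
    l * real_of_ereal (\<omega> y) - q y \<le> l * real_of_ereal (\<omega> z) - q z"
proof -
  let ?f = "\<lambda>z. real_of_ereal (\<omega> z)"
  have pcc: "proper_closed_convex \<omega>" using \<omega> unfolding Legendre_def by auto
  have x': "x \<in> edom \<omega>" using x interior_subset by auto
  have epi_dom: "u \<in> edom \<omega>" "?f u \<le> s" if "(u, s) \<in> eepigraph \<omega>" for u s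
  proof -
    show u: "u \<in> edom \<omega>" unfolding edom_eq_fst_eepigraph[OF pcc] using that by force
    show "?f u \<le> s"
      using that proper_edom_ereal[OF pcc u] unfolding eepigraph_def
      by (metis (no_types, lifting) case_prodD ereal_less_eq(3) mem_Collect_eq)
  qed
  have dom_epi: "(u, ?f u) \<in> eepigraph \<omega>" if "u \<in> edom \<omega>" for u
    using proper_edom_ereal[OF pcc that] unfolding eepigraph_def by simp
  have B: "0 \<le> B" using q by (rule lipschitz_on_nonneg)
  have q_le: "q u \<le> q 0 + B * norm u" for u
    using lipschitz_onD[OF q, of u 0] by (simp add: dist_norm)
  have q_cont: "continuous_on UNIV q" using q by (rule lipschitz_on_continuous_on)
  define t0 where "t0 = l * ?f x - q x"
  define J where "J p = l * snd p - q (fst p)" for p :: "'a \<times> real"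
  have J_cont: "continuous_on UNIV J"
    unfolding J_def
    by (intro continuous_intros continuous_on_compose2[OF q_cont]) auto
  define K where "K = eepigraph \<omega> \<inter> {p. J p \<le> t0}"
  have "closed K"
    unfolding K_def using pcc J_cont unfolding proper_closed_convex_def
    by (intro closed_Int closed_Collect_le) (auto intro!: continuous_intros)
  moreover have "bounded K"
  proof -
    \<comment> \<open>With this slope, l \<omega>(u) exceeds (B + 1)|u| far out, while the level
      condition allows at most \<open>t0 + q 0\<close> plus B|u|. Hence |u| <
      \<open>t0 + q 0\<close>, which the radius \<open>R'\<close> below contradicts.\<close>
    define A where "A = (B + 1) / l"
    have "\<forall>\<^sub>F u in at_infinity. ereal A < \<omega> u / ereal (norm u)"
      using \<omega>(2) unfolding supercoercive_def by (rule order_tendstoD) simp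
    then obtain R where R: "\<And>u. R \<le> norm u \<Longrightarrow> ereal A < \<omega> u / ereal (norm u)"
      unfolding eventually_at_infinity by auto
    define R' where "R' = max (max R 1) (t0 + q 0)"
    have fst_bd: "norm u \<le> R'" if "(u, s) \<in> K" for u s
    proof (rule ccontr)
      assume "\<not> norm u \<le> R'"
      then have u: "R \<le> norm u" "1 < norm u" "t0 + q 0 < norm u" unfolding R'_def by auto
      have us: "(u, s) \<in> eepigraph \<omega>" "l * s - q u \<le> t0" using that unfolding K_def J_def by auto
      have "ereal A < ereal (?f u) / ereal (norm u)"
        using R[OF u(1)] proper_edom_ereal[OF pcc epi_dom(1)[OF us(1)]] by simp
      moreover have "u \<noteq> 0" using u(2) by auto
      ultimately have "A * norm u < ?f u" by (simp add: field_simps)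
      then have "A * norm u < s" using epi_dom(2)[OF us(1)] by linarith
      then have "l * (A * norm u) < l * s" using l by simp
      moreover have "l * (A * norm u) = (B + 1) * norm u" unfolding A_def using l by simp
      ultimately have "(B + 1) * norm u < t0 + q 0 + B * norm u"
        using us(2) q_le[of u] by linarith
      then show False using u(3) by (simp add: algebra_simps)
    qed
    \<comment> \<open>Heights are bounded below by the affine minorant at \<open>x\<close> and above
      by the level condition with the growth bound on \<open>q\<close>.\<close>
    define a where "a = ?f x - norm (grad \<omega> x) * (R' + norm x)"
    define b where "b = (t0 + q 0 + B * R') / l"
    have snd_bd: "s \<in> {a..b}" if us: "(u, s) \<in> K" for u s
    proof -
      have us': "(u, s) \<in> eepigraph \<omega>" "l * s - q u \<le> t0" using us unfolding K_def J_def by auto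
      have "?f x + grad \<omega> x \<bullet> (u - x) \<le> s"
        using grad_inequality[OF \<omega>(1) x epi_dom(1)[OF us'(1)]] epi_dom(2)[OF us'(1)] by linarith
      moreover have "norm (grad \<omega> x) * norm (u - x) \<le> norm (grad \<omega> x) * (R' + norm x)"
        using fst_bd[OF us] norm_triangle_ineq4[of u x] by (intro mult_left_mono) auto
      moreover have "\<bar>grad \<omega> x \<bullet> (u - x)\<bar> \<le> norm (grad \<omega> x) * norm (u - x)"
        by (rule Cauchy_Schwarz_ineq2)
      ultimately have "a \<le> s" unfolding a_def by linarith
      moreover have "B * norm u \<le> B * R'" using B fst_bd[OF us] by (rule mult_left_mono[rotated])
      then have "l * s \<le> t0 + q 0 + B * R'" using us'(2) q_le[of u] by linarith
      then have "s \<le> b" unfolding b_def using l by (simp add: field_simps)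
      ultimately show ?thesis by simp
    qed
    have "K \<subseteq> cball 0 R' \<times> {a..b}" using fst_bd snd_bd by auto
    then show ?thesis
      by (rule bounded_subset[OF bounded_Times[OF bounded_cball bounded_closed_interval]])
  qed
  ultimately have "compact K" by (simp add: compact_eq_bounded_closed)
  moreover have "(x, ?f x) \<in> K" using dom_epi[OF x'] unfolding K_def J_def t0_def by simp
  ultimately obtain p where p: "p \<in> K" "\<And>p'. p' \<in> K \<Longrightarrow> J p \<le> J p'"
    using continuous_attains_inf[of K J] continuous_on_subset[OF J_cont, of K] by blast
  obtain y s where ys: "p = (y, s)" by (cases p)
  have y: "y \<in> edom \<omega>" "?f y \<le> s" using epi_dom[of y s] p(1) unfolding ys K_def by auto
  have "l * ?f y \<le> l * s" using y(2) l by simp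
  then have Jy: "l * ?f y - q y \<le> J p" unfolding J_def ys by simp
  have Jp: "J p \<le> t0" using p(1) unfolding K_def by simp
  have "J p \<le> l * ?f z - q z" if "z \<in> edom \<omega>" for z
  proof (cases "(z, ?f z) \<in> K")
    case True
    then show ?thesis using p(2)[OF True] unfolding J_def by simp
  next
    case False
    \<comment> \<open>A graph point outside \<open>K\<close> has value above \<open>t0\<close>,
      hence above the minimum over \<open>K\<close>.\<close>
    then show ?thesis using Jp dom_epi[OF that] unfolding K_def J_def by auto
  qed
  then show ?thesis using y(1) Jy by (intro bexI[of _ y]) force+
qed

text \<open>Every minimizer is first shown to be interior, because strict convexity is only
  available there; uniqueness then follows by comparing two minimizers with their midpoint.\<close>

lemma Legendre_minus_concave_strict_min:
  fixes \<omega> :: "'a::euclidean_space \<Rightarrow> ereal"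
  assumes \<omega>: "Legendre \<omega>" "supercoercive \<omega>" and x: "x \<in> interior (edom \<omega>)"
    and q: "B-lipschitz_on UNIV q" "concave_on UNIV q" and l: "0 < l"
  shows "\<exists>y\<in>interior (edom \<omega>). \<forall>z\<in>edom \<omega>. z \<noteq> y \<longrightarrow>
    l * real_of_ereal (\<omega> y) - q y < l * real_of_ereal (\<omega> z) - q z"
proof -
  let ?f = "\<lambda>z. real_of_ereal (\<omega> z)"
  let ?P = "\<lambda>y. y \<in> edom \<omega> \<and> (\<forall>z\<in>edom \<omega>. l * ?f y - q y \<le> l * ?f z - q z)"
  have pcc: "proper_closed_convex \<omega>" and sc: "strictly_convex_on (interior (edom \<omega>)) \<omega>"
    using \<omega> unfolding Legendre_def by auto
  have x': "x \<in> edom \<omega>" using x interior_subset by auto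
  have int: "y \<in> interior (edom \<omega>)" if y: "?P y" for y
  proof (rule ccontr)
    assume ny: "y \<notin> interior (edom \<omega>)"
    \<comment> \<open>Moving from \<open>y\<close> by a fraction \<open>t\<close> towards
      \<open>x\<close> changes \<open>q\<close> by at most tB|x - y|, which equals ltK. The steep
      drop of \<omega> outweighs it, so \<open>y\<close> could be improved.\<close>
    define K where "K = B * norm (x - y) / l"
    from Legendre_steep_at_boundary[OF \<omega>(1) x _ ny, of K] y obtain t where
      t: "0 < t" "t < 1" "?f (y + t *\<^sub>R (x - y)) < ?f y - t * K" by auto
    let ?w = "y + t *\<^sub>R (x - y)"
    have "?w = (1 - t) *\<^sub>R y + t *\<^sub>R x" by (simp add: algebra_simps)
    then have "?w \<in> edom \<omega>"
      using convexD[OF convex_edom[OF pcc], of y x "1 - t" t] y x' t by auto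
    then have "l * ?f y - q y \<le> l * ?f ?w - q ?w" using y by auto
    moreover have "l * ?f ?w < l * (?f y - t * K)" using t(3) l by simp
    moreover have "l * (?f y - t * K) = l * ?f y - t * (B * norm (x - y))"
      unfolding K_def using l by (simp add: field_simps)
    moreover have "\<bar>q y - q ?w\<bar> \<le> t * (B * norm (x - y))"
      using lipschitz_onD[OF q(1), of y ?w] t(1) by (simp add: dist_norm mult.left_commute)
    ultimately show False by linarith
  qed
  have unique: "y = z" if y: "?P y" and z: "?P z" for y z
  proof (rule ccontr)
    assume "y \<noteq> z"
    let ?m = "(1 - 1/2) *\<^sub>R y + (1/2) *\<^sub>R z"
    have "\<omega> ?m < ereal (1 - 1/2) * \<omega> y + ereal (1/2) * \<omega> z"
      using sc int[OF y] int[OF z] \<open>y \<noteq> z\<close> unfolding strictly_convex_on_def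
      by (elim conjE ballE allE[of _ "1/2"] impE) auto
    moreover have "?m \<in> edom \<omega>"
      using convexD[OF convex_edom[OF pcc], of y z "1 - 1/2" "1/2"] y z by auto
    moreover note proper_edom_ereal[OF pcc this]
      proper_edom_ereal[OF pcc conjunct1[OF y]] proper_edom_ereal[OF pcc conjunct1[OF z]]
    ultimately have "ereal (?f ?m) < ereal (1 - 1/2) * ereal (?f y) + ereal (1/2) * ereal (?f z)"
      and m: "?m \<in> edom \<omega>" by simp_all
    then have "?f ?m < (1 - 1/2) * ?f y + (1/2) * ?f z" by simp
    then have "l * ?f ?m < l * ((1 - 1/2) * ?f y + (1/2) * ?f z)" using l by simp
    moreover have "(1 - 1/2) * q y + (1/2) * q z \<le> q ?m"
      using q(2) by (intro concave_onD) auto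
    moreover have "l * ?f y - q y \<le> l * ?f ?m - q ?m" "l * ?f z - q z \<le> l * ?f ?m - q ?m"
      using y z m by auto
    ultimately show False by (simp add: algebra_simps)
  qed
  obtain y where y: "?P y"
    using Legendre_minus_lipschitz_attains_min[OF \<omega> x q(1) l] by auto
  \<comment> \<open>A point violating strictness would be a second minimizer.\<close>
  have "l * ?f y - q y < l * ?f z - q z" if "z \<in> edom \<omega>" "z \<noteq> y" for z
  proof (rule ccontr)
    assume "\<not> ?thesis"
    then have "?P z" using y that(1) by force
    then show False using unique y that(2) by auto
  qed
  then show ?thesis using int[OF y] by auto
qed

section \<open>The Bregman step\<close>

lemma bregman_ereal:
  assumes "proper_closed_convex \<omega>" "y \<in> edom \<omega>" "x \<in> edom \<omega>"
  shows "bregman \<omega> y x =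
    ereal (real_of_ereal (\<omega> y) - real_of_ereal (\<omega> x) - grad \<omega> x \<bullet> (y - x))"
proof -
  obtain a b where "\<omega> y = ereal a" "\<omega> x = ereal b"
    using proper_edom_ereal[OF assms(1,2)] proper_edom_ereal[OF assms(1,3)] by metis
  then show ?thesis unfolding bregman_def by simp
qed

lemma bregman_obj_eq:
  fixes C :: "(real^'m) set" and \<omega> :: "real^'n \<Rightarrow> ereal"
  assumes C: "closed C" "convex C" "cone C" "pointed C"
    and \<omega>: "proper_closed_convex \<omega>" and xy: "x \<in> edom \<omega>" "y \<in> edom \<omega>"
  shows "bregman_obj C \<omega> F l x y = ereal
    (lower_support (dual_base C) (jacobian F (at x) *v (x - y)) - l * real_of_ereal (bregman \<omega> y x))"
proof -
  have D: "ereal l * bregman \<omega> y x = ereal (l * real_of_ereal (bregman \<omega> y x))"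
    using bregman_ereal[OF \<omega> xy(2,1)] by simp
  show ?thesis
    unfolding bregman_obj_def D
    by (rule INF_ereal_lower_support[OF dual_base_nonempty[OF C] dual_base_norm_le[where C=C]])
qed

text \<open>Up to the constant l \<omega>(x), the objective is the negative of l \<omega> - q, so
  its maximizer is the strict minimizer found above. The feasible set is
  \<open>edom \<omega>\<close>, which relative smoothness will identify with \<Omega>.\<close>

lemma bregman_step_properties:
  fixes C :: "(real^'m) set" and \<omega> :: "real^'n \<Rightarrow> ereal" and F :: "real^'n \<Rightarrow> real^'m"
  assumes C: "closed C" "convex C" "cone C" "pointed C"
    and \<omega>: "Legendre \<omega>" "supercoercive \<omega>" and l: "0 < l"
    and x: "x \<in> interior (edom \<omega>)"
  defines "y \<equiv> bregman_step C (edom \<omega>) \<omega> F l x"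
  shows "y \<in> interior (edom \<omega>)" "merit_v C (edom \<omega>) \<omega> F l x = bregman_obj C \<omega> F l x y"
proof -
  let ?f = "\<lambda>z. real_of_ereal (\<omega> z)" and ?h = "lower_support (dual_base C)"
  let ?A = "jacobian F (at x)"
  note hs = dual_base_nonempty[OF C] dual_base_norm_le[where C=C]
  have pcc: "proper_closed_convex \<omega>" using \<omega> unfolding Legendre_def by auto
  have x': "x \<in> edom \<omega>" using x interior_subset by auto
  \<comment> \<open>Here \<open>q\<close> joins the scalarized linear model to the linear part of
    the Bregman distance.\<close>
  define q where "q u = ?h (?A *v (x - u)) + l * (grad \<omega> x \<bullet> (u - x))" for u
  have obj: "bregman_obj C \<omega> F l x u = ereal (l * ?f x - (l * ?f u - q u))" if "u \<in> edom \<omega>" for u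
    unfolding bregman_obj_eq[OF C pcc x' that] bregman_ereal[OF pcc that x'] q_def
    by (simp add: algebra_simps)
  obtain b where b: "\<And>u. norm (?A *v u) \<le> norm u * b"
    using bounded_linear.bounded[OF matrix_vector_mul_bounded_linear[of ?A]] by blast
  \<comment> \<open>The operator bound \<open>b\<close> comes without a sign, while a Lipschitz
    constant must be nonnegative.\<close>
  have "\<bar>b\<bar>-lipschitz_on UNIV (\<lambda>u. ?h (?A *v (x - u)))"
  proof (rule lipschitz_onI)
    fix u v
    have est: "?h (?A *v (x - u)) - ?h (?A *v (x - v)) \<le> \<bar>b\<bar> * norm (u - v)" for u v
    proof -
      have "?A *v (x - u) - ?A *v (x - v) = ?A *v (v - u)"
        by (simp add: matrix_vector_mult_diff_distrib)
      then have "?h (?A *v (x - u)) - ?h (?A *v (x - v)) \<le> norm (?A *v (v - u))"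
        using lower_support_diff_le[OF hs, of "?A *v (x - u)" "?A *v (x - v)"] by simp
      also have "\<dots> \<le> norm (v - u) * b" by (rule b)
      also have "\<dots> \<le> norm (v - u) * \<bar>b\<bar>" by (intro mult_left_mono) auto
      finally show ?thesis by (simp add: norm_minus_commute mult.commute)
    qed
    show "dist (?h (?A *v (x - u))) (?h (?A *v (x - v))) \<le> \<bar>b\<bar> * dist u v"
      using est[of u v] est[of v u] by (simp add: dist_norm norm_minus_commute)
  qed auto
  moreover have "(l * norm (grad \<omega> x))-lipschitz_on UNIV (\<lambda>u. l * (grad \<omega> x \<bullet> (u - x)))"
  proof (rule lipschitz_onI)
    fix u v
    have "l * (grad \<omega> x \<bullet> (u - x)) - l * (grad \<omega> x \<bullet> (v - x)) = l * (grad \<omega> x \<bullet> (u - v))"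
      by (simp add: algebra_simps)
    then show "dist (l * (grad \<omega> x \<bullet> (u - x))) (l * (grad \<omega> x \<bullet> (v - x)))
        \<le> l * norm (grad \<omega> x) * dist u v"
      using Cauchy_Schwarz_ineq2[of "grad \<omega> x" "u - v"] l by (simp add: dist_norm abs_mult)
  qed (use l in auto)
  ultimately have lip: "(\<bar>b\<bar> + l * norm (grad \<omega> x))-lipschitz_on UNIV q"
    unfolding q_def by (rule lipschitz_on_add)
  have conc: "concave_on UNIV q"
    unfolding concave_on_def
  proof (rule convex_onI)
    fix t :: real and u v assume t: "0 < t" "t < 1"
    have "?A *v (x - ((1 - t) *\<^sub>R u + t *\<^sub>R v))
        = (1 - t) *\<^sub>R (?A *v (x - u)) + t *\<^sub>R (?A *v (x - v))"
      by (simp add: matrix_vector_mult_diff_distrib matrix_vector_right_distrib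
          matrix_vector_mult_scaleR algebra_simps)
    moreover have "(1 - t) * ?h (?A *v (x - u)) \<le> ?h ((1 - t) *\<^sub>R (?A *v (x - u)))"
      "t * ?h (?A *v (x - v)) \<le> ?h (t *\<^sub>R (?A *v (x - v)))"
      using t by (intro lower_support_scale[OF hs]; simp)+
    ultimately have "(1 - t) * ?h (?A *v (x - u)) + t * ?h (?A *v (x - v))
        \<le> ?h (?A *v (x - ((1 - t) *\<^sub>R u + t *\<^sub>R v)))"
      using lower_support_superadd[OF hs,
          of "(1 - t) *\<^sub>R (?A *v (x - u))" "t *\<^sub>R (?A *v (x - v))"] by simp
    then show "- q ((1 - t) *\<^sub>R u + t *\<^sub>R v) \<le> (1 - t) * - q u + t * - q v"
      unfolding q_def by (simp add: algebra_simps)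
  qed auto
  obtain y0 where y0: "y0 \<in> interior (edom \<omega>)"
    "\<And>z. z \<in> edom \<omega> \<Longrightarrow> z \<noteq> y0 \<Longrightarrow> l * ?f y0 - q y0 < l * ?f z - q z"
    using Legendre_minus_concave_strict_min[OF \<omega> x lip conc l] by blast
  have y0': "y0 \<in> edom \<omega>" using y0(1) interior_subset by auto
  \<comment> \<open>This strict domination yields existence and uniqueness for the definite
    description, and the value of the supremum.\<close>
  have less: "bregman_obj C \<omega> F l x z < bregman_obj C \<omega> F l x y0" if "z \<in> edom \<omega>" "z \<noteq> y0" for z
    using y0(2)[OF that] obj[OF that(1)] obj[OF y0'] by simp
  have "is_arg_max (bregman_obj C \<omega> F l x) (\<lambda>y. y \<in> edom \<omega>) y0"
    unfolding is_arg_max_def using y0' less by (metis less_asym less_irrefl)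
  moreover have "z = y0" if "is_arg_max (bregman_obj C \<omega> F l x) (\<lambda>y. y \<in> edom \<omega>) z" for z
    using that less y0' unfolding is_arg_max_def by blast
  ultimately have y: "y = y0" unfolding y_def bregman_step_def by (rule the_equality)
  show "y \<in> interior (edom \<omega>)" using y y0(1) by simp
  show "merit_v C (edom \<omega>) \<omega> F l x = bregman_obj C \<omega> F l x y"
    unfolding merit_v_def y using y0' less by (intro SUP_eqI) (auto simp: le_less)
qed

section \<open>Descent of the merit function and the linear rate\<close>

text \<open>Each scalarization by the dual base decreases by at least the same amount
  \<open>V\<close>, so the decrease survives the infimum over the base and the supremum over
  \<open>S\<close>. That \<open>y\<close> is the Bregman step enters only in the theorem.\<close>

lemma merit_u0_descent:
  fixes C :: "(real^'m) set" and \<omega> :: "real^'n \<Rightarrow> ereal" and F :: "real^'n \<Rightarrow> real^'m"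
  assumes C: "closed C" "convex C" "cone C" "pointed C"
    and \<omega>: "Legendre \<omega>" and e: "normalized_direction C e"
    and smooth: "0 < L" "relatively_smooth_on (edom \<omega>) L C e \<omega> F" and l: "L \<le> l"
    and x: "x \<in> interior (edom \<omega>)" and y: "y \<in> interior (edom \<omega>)"
  shows "merit_u0 C S F y \<le> merit_u0 C S F x - bregman_obj C \<omega> F l x y"
proof -
  let ?h = "lower_support (dual_base C)" and ?v = "jacobian F (at x) *v (x - y)"
  let ?D = "real_of_ereal (bregman \<omega> y x)"
  note hs = dual_base_nonempty[OF C] dual_base_norm_le[where C=C]
  have pcc: "proper_closed_convex \<omega>" using \<omega> unfolding Legendre_def by auto
  have x': "x \<in> edom \<omega>" and y': "y \<in> edom \<omega>" using x y interior_subset by auto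
  define V where "V = ?h ?v - l * ?D"
  have obj: "bregman_obj C \<omega> F l x y = ereal V"
    unfolding V_def by (rule bregman_obj_eq[OF C pcc x' y'])
  have D: "0 \<le> ?D" using grad_inequality[OF \<omega> x y'] bregman_ereal[OF pcc y' x'] by simp
  have inC: "F x - ?v + (L * ?D) *\<^sub>R e - F y \<in> C"
  proof -
    have "jacobian F (at x) *v (y - x) = - ?v" by (simp add: matrix_vector_mult_diff_distrib)
    then show ?thesis using smooth(2) x y unfolding relatively_smooth_on_def cone_le_def by force
  qed
  have key: "c \<bullet> F y \<le> c \<bullet> F x - V" if c: "c \<in> dual_base C" for c
  proof -
    have "0 \<le> c \<bullet> (F x - ?v + (L * ?D) *\<^sub>R e - F y)"
      using c inC dual_base_subset_dual_cone[of C] unfolding dual_cone_def by blast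
    then have "c \<bullet> F y \<le> c \<bullet> F x - c \<bullet> ?v + (L * ?D) * (c \<bullet> e)"
      by (simp add: inner_diff_right inner_add_right)
    moreover have "(L * ?D) * (c \<bullet> e) \<le> (L * ?D) * 1"
      using smooth(1) D inner_normalized_direction_le[OF e c] by (intro mult_left_mono) auto
    moreover have "L * ?D \<le> l * ?D" using l D by (rule mult_right_mono)
    \<comment> \<open>Replacing the linear term by its infimum over the base makes the bound
      independent of \<open>c\<close>.\<close>
    moreover have "?h ?v \<le> c \<bullet> ?v" by (rule lower_support_le[OF hs c])
    ultimately show ?thesis unfolding V_def by linarith
  qed
  have INF_eq: "(INF c\<in>dual_base C. ereal (c \<bullet> v)) = ereal (?h v)" for v
    using INF_ereal_lower_support[OF hs, of v 0] by simp
  show ?thesis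
    unfolding obj merit_u0_def INF_eq
  proof (rule SUP_least)
    fix z assume z: "z \<in> S"
    have "?h (F y - F z) + V \<le> ?h (F x - F z)"
    proof (rule lower_support_greatest[OF hs])
      fix c assume c: "c \<in> dual_base C"
      show "?h (F y - F z) + V \<le> c \<bullet> (F x - F z)"
        using lower_support_le[OF hs c, of "F y - F z"] key[OF c]
        by (simp add: inner_diff_right)
    qed auto
    \<comment> \<open>The supremum may be infinite, so the real \<open>V\<close> is first added on
      the left and then moved across.\<close>
    then have "ereal (?h (F y - F z)) + ereal V \<le> (SUP z\<in>S. ereal (?h (F x - F z)))"
      using z by (intro SUP_upper2) auto
    then show "ereal (?h (F y - F z)) \<le> (SUP z\<in>S. ereal (?h (F x - F z))) - ereal V"
      by (simp add: ereal_le_minus)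
  qed
qed

text \<open>The competitor \<open>y = x\<close> contributes 0. Together with the Bregman-PL bound
  this makes the merit value at each iterate a real number.\<close>

lemma merit_u0_nonneg:
  assumes "x \<in> S" shows "0 \<le> merit_u0 C S F x"
  unfolding merit_u0_def by (rule SUP_upper2[OF assms], rule INF_greatest) simp

theorem theorem5:
  fixes C :: "(real^'m) set" and \<Omega> :: "(real^'n) set"
    and F :: "real^'n \<Rightarrow> real^'m" and \<omega> :: "real^'n \<Rightarrow> ereal"
    and e :: "real^'m" and L l :: real and \<tau> :: "real \<Rightarrow> real"
    and x :: "nat \<Rightarrow> real^'n"
  assumes C: "closed C" "convex C" "cone C" "pointed C" "interior C \<noteq> {}"
    and \<Omega>: "closed \<Omega>" "convex \<Omega>" "interior \<Omega> \<noteq> {}"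
    and F: "\<And>z. F differentiable (at z)"
    and \<omega>: "Legendre \<omega>" "closure (edom \<omega>) = \<Omega>" "supercoercive \<omega>"
    and e: "normalized_direction C e"
    and \<tau>_pos: "\<And>l'. 0 < l' \<Longrightarrow> 0 < \<tau> l'"
    and PL: "\<And>z l'. z \<in> interior \<Omega> \<Longrightarrow> 0 < l' \<Longrightarrow>
               merit_u0 C \<Omega> F z \<le> ereal (\<tau> l') * merit_v C \<Omega> \<omega> F l' z"
    and smooth: "0 < L" "relatively_smooth_on \<Omega> L C e \<omega> F"
    and l: "L \<le> l"
    and x_init: "x 0 \<in> interior \<Omega>"
    and x_step: "\<And>k. x (Suc k) = bregman_step C \<Omega> \<omega> F l (x k)"
    and no_stop: "\<And>k. x (Suc k) \<noteq> x k"
    and not_stationary: "\<And>k. \<not> C_stationary C \<Omega> F (x k)"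
  shows "\<forall>k. merit_u0 C \<Omega> F (x (Suc k)) \<le> ereal (1 - 1 / \<tau> l) * merit_u0 C \<Omega> F (x k)"
proof
  fix k
  \<comment> \<open>One inclusion comes from the closure condition, the other from relative
    smoothness.\<close>
  have dom: "edom \<omega> = \<Omega>"
  proof
    show "edom \<omega> \<subseteq> \<Omega>" using closure_subset[of "edom \<omega>"] unfolding \<omega>(2) .
    show "\<Omega> \<subseteq> edom \<omega>" using smooth(2) unfolding relatively_smooth_on_def by (rule conjunct1)
  qed
  have lpos: "0 < l" using smooth(1) l by linarith
  note step = bregman_step_properties[OF C(1-4) \<omega>(1,3) lpos, where F=F, unfolded dom]
  have int: "x k \<in> interior \<Omega>" for k
    by (induction k) (use x_init step(1) x_step in auto)
  have xk: "x k \<in> \<Omega>" using int[of k] interior_subset by auto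
  have "x n \<in> edom \<omega>" for n using int[of n] interior_subset dom by auto
  then obtain V where V: "bregman_obj C \<omega> F l (x k) (x (Suc k)) = ereal V"
    using bregman_obj_eq[OF C(1-4)] \<omega>(1) unfolding Legendre_def by blast
  \<comment> \<open>The PL inequality is taken at the step parameter \<open>l\<close> itself, where
    the merit value is attained at the next iterate and so equals \<open>V\<close>.\<close>
  have PLk: "merit_u0 C \<Omega> F (x k) \<le> ereal (\<tau> l * V)"
    using PL[OF int lpos, of k] step(2)[OF int, of k] V x_step by simp
  obtain U where U: "merit_u0 C \<Omega> F (x k) = ereal U"
    using PLk merit_u0_nonneg[OF xk, of C F] by (cases "merit_u0 C \<Omega> F (x k)") auto
  have "merit_u0 C \<Omega> F (x (Suc k)) \<le> ereal (U - V)"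
    using merit_u0_descent[OF C(1-4) \<omega>(1) e smooth(1), of F l "x k" "x (Suc k)" \<Omega>]
      smooth(2) l int U V dom by simp
  \<comment> \<open>Dividing the PL bound by \<tau>(l) > 0 gives V \<ge> U / \<tau>(l).\<close>
  also have "\<dots> \<le> ereal ((1 - 1 / \<tau> l) * U)"
    using PLk U \<tau>_pos[OF lpos] by (simp add: field_simps)
  finally show "merit_u0 C \<Omega> F (x (Suc k)) \<le> ereal (1 - 1 / \<tau> l) * merit_u0 C \<Omega> F (x k)"
    using U by simp
qed

end
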